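(* There is a club (closed unbounded set) $A\subseteq\omega_1$ which is an antichain with respect to $\le_s$; that is, for any two distinct $\alpha,\beta\in A$ we have $\alpha\not\le_s\beta$ and $\beta\not\le_s\alpha$.
   Context: Work in ZFC. Ordinals are identified with the linear orders $(\eta,<)$. All languages are countable. A copy of a countable structure $\mathcal{A}$ is an isomorphic structure with domain $\omega$ (identified with its atomic diagram, a subset of $\omega$). $\Phi_e$ denotes the $e$-th Turing functional. For countable structures, $\mathcal{A}\le_s\mathcal{B}$ (Medvedev reducibility) means: there is $e\in\omega$ such that for every copy $B$ of $\mathcal{B}$, $\Phi_e^B$ is total and is (the atomic diagram of) a copy of $\mathcal{A}$. *)

theory Defs
  imports Main "HOL-Library.Nat_Bijection"
begin

text \<open>omega_1 is the successor cardinal of omega, realised as the well-order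
  cardSuc natLeq (a well-order on a set of nat sets). A countable ordinal alpha
  is an element of its field; as a linear order it is the set of its strict
  predecessors with the induced strict order.\<close>

definition omega1 :: "nat set rel" where
  "omega1 = cardSuc natLeq"

definition w1_less :: "nat set \<Rightarrow> nat set \<Rightarrow> bool" where
  "w1_less x y \<longleftrightarrow> (x, y) \<in> omega1 \<and> x \<noteq> y"

definition club_w1 :: "nat set set \<Rightarrow> bool" where
  "club_w1 A \<longleftrightarrow> A \<subseteq> Field omega1
     \<and> (\<forall>\<alpha>\<in>Field omega1. \<exists>\<beta>\<in>A. w1_less \<alpha> \<beta>)
     \<and> (\<forall>\<alpha>\<in>Field omega1.
          ((\<exists>\<beta>\<in>A. w1_less \<beta> \<alpha>) \<and>
           (\<forall>\<gamma>. w1_less \<gamma> \<alpha> \<longrightarrow> (\<exists>\<beta>\<in>A. w1_less \<gamma> \<beta> \<and> w1_less \<beta> \<alpha>)))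
          \<longrightarrow> \<alpha> \<in> A)"

definition ord_dom :: "nat set \<Rightarrow> nat set set" where
  "ord_dom \<alpha> = {\<gamma>. w1_less \<gamma> \<alpha>}"

datatype rf = Zero | Succ | Proj nat | Oracle | Comp rf "rf list" | Prim rf rf | Mu rf

inductive ev :: "(nat \<Rightarrow> bool) \<Rightarrow> rf \<Rightarrow> nat list \<Rightarrow> nat \<Rightarrow> bool" for X where
  ev_zero: "ev X Zero xs 0"
| ev_succ: "ev X Succ (x # xs) (Suc x)"
| ev_proj: "i < length xs \<Longrightarrow> ev X (Proj i) xs (xs ! i)"
| ev_oracle: "ev X Oracle (x # xs) (if X x then 1 else 0)"
| ev_comp: "list_all2 (\<lambda>g y. ev X g xs y) gs ys \<Longrightarrow> ev X f ys z \<Longrightarrow> ev X (Comp f gs) xs z"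
| ev_prim0: "ev X f xs z \<Longrightarrow> ev X (Prim f g) (0 # xs) z"
| ev_primS: "ev X (Prim f g) (n # xs) y \<Longrightarrow> ev X g (n # y # xs) z \<Longrightarrow> ev X (Prim f g) (Suc n # xs) z"
| ev_mu: "ev X f (n # xs) 0 \<Longrightarrow> (\<forall>m<n. \<exists>y. y \<noteq> 0 \<and> ev X f (m # xs) y) \<Longrightarrow> ev X (Mu f) xs n"

definition computes :: "rf \<Rightarrow> nat set \<Rightarrow> nat set \<Rightarrow> bool" where
  "computes p X D \<longleftrightarrow> (\<forall>n. ev (\<lambda>x. x \<in> X) p [n] (if n \<in> D then 1 else 0))"

text \<open>Atomic diagram of a structure (omega, R) in the language {<} (with equality):
  the sentence i = j is coded by 2 * <i,j>, the sentence i < j by 2 * <i,j> + 1.\<close>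
definition diag :: "(nat \<Rightarrow> nat \<Rightarrow> bool) \<Rightarrow> nat set" where
  "diag R = {2 * prod_encode (i, i) | i. True} \<union> {2 * prod_encode (i, j) + 1 | i j. R i j}"

definition is_copy :: "'a set \<Rightarrow> ('a \<Rightarrow> 'a \<Rightarrow> bool) \<Rightarrow> nat set \<Rightarrow> bool" where
  "is_copy L lt D \<longleftrightarrow> (\<exists>f. bij_betw f UNIV L \<and> D = diag (\<lambda>i j. lt (f i) (f j)))"

definition medv_le :: "'a set \<Rightarrow> ('a \<Rightarrow> 'a \<Rightarrow> bool) \<Rightarrow> 'b set \<Rightarrow> ('b \<Rightarrow> 'b \<Rightarrow> bool) \<Rightarrow> bool" where
  "medv_le LA ltA LB ltB \<longleftrightarrow>
     (\<exists>p. \<forall>B. is_copy LB ltB B \<longrightarrow> (\<exists>D. is_copy LA ltA D \<and> computes p B D))"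

definition ord_medv_le :: "nat set \<Rightarrow> nat set \<Rightarrow> bool" where
  "ord_medv_le \<alpha> \<beta> \<longleftrightarrow> medv_le (ord_dom \<alpha>) w1_less (ord_dom \<beta>) w1_less"

end

theory Submission
  imports Defs "HOL-Library.Sublist" "HOL-Library.Countable_Set_Type"
begin

text \<open>Only countably many \<open>\<beta>\<close> reduce to a given infinite \<open>\<alpha>\<close>, because a functional and a copy of
  \<open>\<alpha>\<close> determine \<open>\<beta>\<close>; so closing off under \<open>\<alpha> \<mapsto> {\<beta>. \<beta> \<le> \<alpha>}\<close> gives a club without reductions
  of larger to smaller ordinals.

  For the other direction, force with finite injective sequences from \<open>\<beta>\<close> to add a generic copy of
  \<open>\<beta>\<close>. For a functional \<open>e\<close>, the relation saying that a condition forces the number \<open>k\<close> to have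
  rank \<open>\<xi>\<close> in the output of \<open>e\<close> is defined by recursion on \<open>\<xi>\<close>, and it makes sense over all of
  \<open>omega1\<close> as well. By a Loewenheim-Skolem argument there is a club of \<open>\<beta>\<close> for which the relation
  over \<open>\<beta>\<close>, for ranks below \<open>\<beta>\<close>, is the restriction of the one over \<open>omega1\<close>. If \<open>\<beta>\<close> lies in this
  club and \<open>e\<close> reduces some \<open>\<alpha> < \<beta>\<close> to \<open>\<beta>\<close>, then \<open>\<alpha>\<close> is the least rank that is not forced over
  \<open>omega1\<close> by any condition, so \<open>\<alpha>\<close> depends on \<open>e\<close> only. Hence only countably many \<open>\<alpha>\<close> reduce to
  some larger \<open>\<beta>\<close> in the club, and it remains to take a tail of it.\<close>

section \<open>Oracle computations\<close>

text \<open>In the search case, two searches with different results conflict: the later one has a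
  nonzero value recorded where the earlier one found zero.\<close>

lemma ev_functional: "ev X p xs y \<Longrightarrow> ev X p xs z \<Longrightarrow> z = y"
proof (induction arbitrary: z rule: ev.induct)
  case (ev_comp xs gs ys f w)
  from ev_comp.prems obtain ys' where ys': "list_all2 (\<lambda>g y. ev X g xs y) gs ys'" "ev X f ys' z"
    by (cases rule: ev.cases) auto
  have "ys' = ys"
    using ev_comp.IH(1) ys'(1) unfolding list_all2_conv_all_nth
    by (intro nth_equalityI) auto
  with ys'(2) ev_comp.IH(2) show ?case by simp
next
  case (ev_mu f n xs)
  from ev_mu.prems have z: "ev X f (z # xs) 0" "\<forall>m<z. \<exists>y. y \<noteq> 0 \<and> ev X f (m # xs) y"
    by (cases rule: ev.cases; auto)+
  show ?case
  proof (rule linorder_cases[of z n])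
    assume "z < n"
    then show ?thesis using ev_mu.IH(2) z(1) by blast
  next
    assume "n < z"
    then show ?thesis using ev_mu.IH(1) z(2) by blast
  qed auto
next
  case (ev_prim0 f xs w g)
  from ev_prim0.prems show ?case by (cases rule: ev.cases) (use ev_prim0.IH in auto)
next
  case (ev_primS f g n xs y w)
  from ev_primS.prems obtain y' where "ev X (Prim f g) (n # xs) y'" "ev X g (n # y' # xs) z"
    by (cases rule: ev.cases) auto
  then show ?case using ev_primS.IH by blast
qed (erule ev.cases; simp)+

text \<open>The use principle: a halting computation asks only finitely many oracle questions. For
  composition and search, the sum of the bounds for the subcomputations is a common bound.\<close>

lemma ev_use:
  "ev X p xs y \<Longrightarrow> \<exists>N. \<forall>Y. (\<forall>i<N. X i = Y i) \<longrightarrow> ev Y p xs y"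
proof (induction rule: ev.induct)
  case (ev_oracle x xs)
  show ?case
  proof (intro exI[of _ "Suc x"] allI impI)
    fix Y assume "\<forall>i<Suc x. X i = Y i"
    then show "ev Y Oracle (x # xs) (if X x then 1 else 0)"
      using ev.ev_oracle[of Y x xs] by simp
  qed
next
  case (ev_comp xs gs ys f z)
  have len: "length gs = length ys" using ev_comp.IH(1) by (rule list_all2_lengthD)
  have "\<forall>i. \<exists>N. i < length gs \<longrightarrow> (\<forall>Y. (\<forall>i<N. X i = Y i) \<longrightarrow> ev Y (gs ! i) xs (ys ! i))"
    using ev_comp.IH(1) by (auto simp: list_all2_conv_all_nth)
  from choice[OF this]
  obtain h where h: "\<And>i Y. i < length gs \<Longrightarrow> \<forall>j<h i. X j = Y j \<Longrightarrow> ev Y (gs ! i) xs (ys ! i)"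
    by auto
  from ev_comp.IH(2) obtain N where N: "\<And>Y. \<forall>i<N. X i = Y i \<Longrightarrow> ev Y f ys z" by blast
  show ?case
  proof (intro exI[of _ "N + sum h {..<length gs}"] allI impI)
    fix Y assume Y: "\<forall>i<N + sum h {..<length gs}. X i = Y i"
    have "ev Y (gs ! i) xs (ys ! i)" if "i < length gs" for i
    proof (rule h[OF that], intro allI impI)
      fix j assume "j < h i"
      also have "h i \<le> sum h {..<length gs}" using that by (intro member_le_sum) auto
      finally show "X j = Y j" using Y by simp
    qed
    then have "list_all2 (\<lambda>g y. ev Y g xs y) gs ys" using len by (simp add: list_all2_conv_all_nth)
    moreover have "ev Y f ys z" using N Y by simp
    ultimately show "ev Y (Comp f gs) xs z" by (rule ev.ev_comp)
  qed
next
  case (ev_prim0 f xs z g)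
  then obtain N where "\<forall>Y. (\<forall>i<N. X i = Y i) \<longrightarrow> ev Y f xs z" by blast
  then show ?case by (intro exI[of _ N]) (simp add: ev.ev_prim0)
next
  case (ev_primS f g n xs y z)
  then obtain N M where "\<And>Y. \<forall>i<N. X i = Y i \<Longrightarrow> ev Y (Prim f g) (n # xs) y"
    "\<And>Y. \<forall>i<M. X i = Y i \<Longrightarrow> ev Y g (n # y # xs) z" by blast
  then show ?case using ev.ev_primS by (intro exI[of _ "N + M"]) (metis trans_less_add1 trans_less_add2)
next
  case (ev_mu f n xs)
  then obtain N where N: "\<And>Y. \<forall>i<N. X i = Y i \<Longrightarrow> ev Y f (n # xs) 0" by blast
  have "\<forall>m<n. \<exists>M y. y \<noteq> 0 \<and> (\<forall>Y. (\<forall>i<M. X i = Y i) \<longrightarrow> ev Y f (m # xs) y)"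
    using ev_mu.IH(2) by blast
  then obtain h v where h: "\<And>m. m < n \<Longrightarrow> v m \<noteq> 0"
    "\<And>m Y. m < n \<Longrightarrow> \<forall>i<h m. X i = Y i \<Longrightarrow> ev Y f (m # xs) (v m)"
    by metis
  show ?case
  proof (intro exI[of _ "N + sum h {..<n}"] allI impI)
    fix Y assume Y: "\<forall>i<N + sum h {..<n}. X i = Y i"
    have "ev Y f (m # xs) (v m)" if "m < n" for m
    proof (rule h(2)[OF that], intro allI impI)
      fix j assume "j < h m"
      also have "h m \<le> sum h {..<n}" using that by (intro member_le_sum) auto
      finally show "X j = Y j" using Y by simp
    qed
    moreover have "ev Y f (n # xs) 0" using N Y by simp
    ultimately show "ev Y (Mu f) xs n" using h(1) by (intro ev.ev_mu) blast+
  qed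
qed (auto intro: ev.intros)

text \<open>Exceptional sets of ordinals will be indexed by procedures; this makes them
  countable.\<close>

instance rf :: countable
  by countable_datatype

lemma even_mem_diag: "2 * prod_encode (i, j) \<in> diag R \<longleftrightarrow> i = j"
  unfolding diag_def by auto presburger

lemma odd_mem_diag: "2 * prod_encode (i, j) + 1 \<in> diag R \<longleftrightarrow> R i j"
proof -
  have "2 * a + 1 \<noteq> 2 * b" for a b :: nat by presburger
  then show ?thesis unfolding diag_def by auto
qed

section \<open>The order of the countable ordinals\<close>

lemma Card_order_omega1: "Card_order omega1"
  unfolding omega1_def by (rule cardSuc_Card_order[OF natLeq_Card_order])

lemma Well_order_omega1: "Well_order omega1"
  using Card_order_omega1 by (simp add: card_order_on_def)

lemma w1_less_Field: "w1_less x y \<Longrightarrow> x \<in> Field omega1 \<and> y \<in> Field omega1"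
  unfolding w1_less_def Field_def by auto

lemma w1_less_irrefl [simp]: "\<not> w1_less x x"
  by (simp add: w1_less_def)

lemma w1_less_trans: "w1_less x y \<Longrightarrow> w1_less y z \<Longrightarrow> w1_less x z"
  using Well_order_omega1
  unfolding w1_less_def well_order_on_def linear_order_on_def partial_order_on_def preorder_on_def
  by (meson antisymD transD)

lemma w1_less_linear:
  "x \<in> Field omega1 \<Longrightarrow> y \<in> Field omega1 \<Longrightarrow> w1_less x y \<or> x = y \<or> w1_less y x"
  using Well_order_omega1
  unfolding w1_less_def well_order_on_def linear_order_on_def total_on_def by blast

lemma wf_w1_less: "wf {(x, y). w1_less x y}"
proof -
  have "{(x, y). w1_less x y} = omega1 - Id" by (auto simp: w1_less_def)
  then show ?thesis using Well_order_omega1 by (simp add: well_order_on_def)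
qed

lemma w1_less_induct [case_names less]:
  "(\<And>x. (\<And>y. w1_less y x \<Longrightarrow> Q y) \<Longrightarrow> Q x) \<Longrightarrow> Q a"
  using wf_induct_rule[OF wf_w1_less, of Q a] by blast

lemma w1_less_ext:
  assumes "x \<in> Field omega1" "y \<in> Field omega1" "\<And>z. w1_less z x \<longleftrightarrow> w1_less z y"
  shows "x = y"
  using w1_less_linear[OF assms(1,2)] assms(3)[of x] assms(3)[of y] by auto

lemma ord_dom_Field: "ord_dom \<alpha> \<subseteq> Field omega1"
  using w1_less_Field by (auto simp: ord_dom_def)

lemma countable_ord_dom:
  includes cardinal_syntax
  shows "countable (ord_dom \<alpha>)"
proof (cases "\<alpha> \<in> Field omega1")
  case True
  have "|underS omega1 \<alpha>| <o omega1"
    using card_of_underS[OF Card_order_omega1 True] .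
  then have "|underS omega1 \<alpha>| \<le>o natLeq"
    unfolding omega1_def using cardSuc_ordLess_ordLeq natLeq_Card_order card_of_Card_order
    by (metis cardSuc_ordLeq_ordLess)
  moreover have "underS omega1 \<alpha> = ord_dom \<alpha>"
    unfolding underS_def ord_dom_def w1_less_def by auto
  ultimately show ?thesis
    by (simp add: countable_card_le_natLeq)
next
  case False
  then have "ord_dom \<alpha> = {}" using w1_less_Field by (auto simp: ord_dom_def)
  then show ?thesis by simp
qed

lemma uncountable_Field_omega1:
  includes cardinal_syntax
  shows "uncountable (Field omega1)"
proof
  assume "countable (Field omega1)"
  then have "|Field omega1| \<le>o natLeq" by (simp add: countable_card_le_natLeq)
  then have "omega1 \<le>o natLeq"
    using card_of_Field_ordIso[OF Card_order_omega1] ordIso_ordLeq_trans ordIso_symmetric by blast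
  moreover have "natLeq <o omega1"
    unfolding omega1_def by (rule cardSuc_greater[OF natLeq_Card_order])
  ultimately show False using not_ordLess_ordLeq by blast
qed

text \<open>The least element outside \<open>K\<close> serves as \<beta>; it exists because
  \<open>Field omega1\<close> is uncountable.\<close>

lemma countable_downset_eq_ord_dom:
  assumes "countable K" "K \<subseteq> Field omega1" "\<And>x y. x \<in> K \<Longrightarrow> w1_less y x \<Longrightarrow> y \<in> K"
  obtains \<beta> where "\<beta> \<in> Field omega1" "K = ord_dom \<beta>"
proof -
  have "Field omega1 - K \<noteq> {}"
    using assms(1) uncountable_Field_omega1 countable_subset by auto
  then obtain \<beta> where \<beta>: "\<beta> \<in> Field omega1 - K"
    "\<And>y. w1_less y \<beta> \<Longrightarrow> y \<notin> Field omega1 - K"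
    using wf_w1_less unfolding wf_eq_minimal by (metis (mono_tags, lifting) all_not_in_conv case_prodI mem_Collect_eq)
  have "K = ord_dom \<beta>"
  proof (intro set_eqI iffI)
    fix x assume "x \<in> K"
    then show "x \<in> ord_dom \<beta>"
      using w1_less_linear[of x \<beta>] assms(2,3) \<beta>(1) unfolding ord_dom_def by blast
  next
    fix x assume "x \<in> ord_dom \<beta>"
    then show "x \<in> K" using \<beta>(2) ord_dom_Field unfolding ord_dom_def by blast
  qed
  with \<beta>(1) that show thesis by blast
qed

section \<open>Clubs of closure points\<close>

lemma ord_dom_mono: "w1_less \<alpha> \<beta> \<Longrightarrow> ord_dom \<alpha> \<subseteq> ord_dom \<beta>"
  using w1_less_trans by (auto simp: ord_dom_def)

text \<open>List arguments and set values let a single \<open>W\<close> stand for countably many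
  Skolem functions of all finite arities.\<close>

definition closed_points :: "(nat set list \<Rightarrow> nat set set) \<Rightarrow> nat set set" where
  "closed_points W = {\<beta> \<in> Field omega1. \<forall>l\<in>lists (ord_dom \<beta>). W l \<subseteq> ord_dom \<beta>}"

text \<open>For unboundedness, close a point under \<open>W\<close> and predecessors in omega steps;
  the union is a countable initial segment. For closedness, a finite list below a limit of closed
  points already lies below one of them.\<close>

lemma club_closed_points:
  assumes W: "\<And>l. countable (W l)" "\<And>l. W l \<subseteq> Field omega1"
  shows "club_w1 (closed_points W)"
  unfolding club_w1_def
proof (intro conjI ballI impI)
  show "closed_points W \<subseteq> Field omega1" by (auto simp: closed_points_def)
next
  fix \<alpha> assume \<alpha>: "\<alpha> \<in> Field omega1"
  define step where "step X = X \<union> (\<Union>l\<in>lists X. W l) \<union> (\<Union>x\<in>X. ord_dom x)" for X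
  define K where "K n = (step ^^ n) {\<alpha>}" for n
  have K0: "K 0 = {\<alpha>}" and KS: "K (Suc n) = step (K n)" for n by (simp_all add: K_def)
  have cK: "countable (K n) \<and> K n \<subseteq> Field omega1" for n
  proof (induction n)
    case 0
    show ?case using \<alpha> by (simp add: K0)
  next
    case (Suc n)
    have "countable (step (K n))"
      using Suc W(1) countable_ord_dom by (auto simp: step_def)
    moreover have "step (K n) \<subseteq> Field omega1"
      using Suc W(2) ord_dom_Field unfolding step_def by blast
    ultimately show ?case by (simp add: KS)
  qed
  have K_mono: "K m \<subseteq> K n" if "m \<le> n" for m n
    using that by (rule lift_Suc_mono_le[rotated]) (auto simp: KS step_def)
  have "y \<in> (\<Union>n. K n)" if "x \<in> (\<Union>n. K n)" "w1_less y x" for x y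
  proof -
    from that(1) obtain n where "x \<in> K n" by blast
    then have "y \<in> K (Suc n)" using that(2) by (auto simp: KS step_def ord_dom_def)
    then show ?thesis by blast
  qed
  then obtain \<beta> where \<beta>: "\<beta> \<in> Field omega1" "(\<Union>n. K n) = ord_dom \<beta>"
    using cK by (elim countable_downset_eq_ord_dom[rotated 2]) auto
  \<comment> \<open>Lists are finite, so each appears at a finite stage and its value is added at
    the next one.\<close>
  have fin: "\<exists>n. set l \<subseteq> K n" if "set l \<subseteq> (\<Union>n. K n)" for l
    using that
  proof (induction l)
    case (Cons a l)
    then obtain n m where "set l \<subseteq> K n" "a \<in> K m" by auto
    then have "set (a # l) \<subseteq> K (max m n)"
      using K_mono[of n "max m n"] K_mono[of m "max m n"] by auto
    then show ?case by blast
  qed auto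
  have "W l \<subseteq> ord_dom \<beta>" if "l \<in> lists (ord_dom \<beta>)" for l
  proof -
    have "set l \<subseteq> (\<Union>n. K n)" using that \<beta>(2) by auto
    then obtain n where "set l \<subseteq> K n" using fin by blast
    then have "W l \<subseteq> K (Suc n)" unfolding KS step_def by (auto simp: lists_eq_set)
    then show ?thesis using \<beta>(2) by blast
  qed
  moreover have "w1_less \<alpha> \<beta>"
    using K0 \<beta>(2) unfolding ord_dom_def by blast
  ultimately show "\<exists>\<beta>\<in>closed_points W. w1_less \<alpha> \<beta>"
    using \<beta>(1) by (auto simp: closed_points_def)
next
  fix \<alpha> assume \<alpha>: "\<alpha> \<in> Field omega1"
    "(\<exists>\<beta>\<in>closed_points W. w1_less \<beta> \<alpha>) \<and>
     (\<forall>\<gamma>. w1_less \<gamma> \<alpha> \<longrightarrow> (\<exists>\<beta>\<in>closed_points W. w1_less \<gamma> \<beta> \<and> w1_less \<beta> \<alpha>))"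
  have fin: "\<exists>\<beta>\<in>closed_points W. w1_less \<beta> \<alpha> \<and> set l \<subseteq> ord_dom \<beta>"
    if "set l \<subseteq> ord_dom \<alpha>" for l
    using that
  proof (induction l)
    case Nil
    then show ?case using \<alpha>(2) by auto
  next
    case (Cons a l)
    then obtain \<beta> where \<beta>: "\<beta> \<in> closed_points W" "w1_less \<beta> \<alpha>" "set l \<subseteq> ord_dom \<beta>" by auto
    have "w1_less a \<alpha>" using Cons.prems by (simp add: ord_dom_def)
    then obtain \<gamma> where \<gamma>: "\<gamma> \<in> closed_points W" "w1_less a \<gamma>" "w1_less \<gamma> \<alpha>" using \<alpha>(2) by blast
    \<comment> \<open>The larger of \<beta> and \<gamma> bounds the whole list.\<close>
    show ?case
    proof (cases "w1_less \<beta> \<gamma>")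
      case True
      then have "set (a # l) \<subseteq> ord_dom \<gamma>" 
        using \<beta>(3) \<gamma>(2) ord_dom_mono[OF True] by (auto simp: ord_dom_def)
      then show ?thesis using \<gamma> by blast
    next
      case False
      then have "w1_less a \<beta>"
        using w1_less_linear[of \<beta> \<gamma>] \<gamma>(2,3) \<beta>(2) w1_less_Field w1_less_trans by blast
      then have "set (a # l) \<subseteq> ord_dom \<beta>" using \<beta>(3) by (auto simp: ord_dom_def)
      then show ?thesis using \<beta> by blast
    qed
  qed
  have "W l \<subseteq> ord_dom \<alpha>" if "l \<in> lists (ord_dom \<alpha>)" for l
  proof -
    obtain \<beta> where "\<beta> \<in> closed_points W" "w1_less \<beta> \<alpha>" "set l \<subseteq> ord_dom \<beta>"
      using fin[of l] \<open>l \<in> lists (ord_dom \<alpha>)\<close> by auto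
    then show ?thesis using ord_dom_mono[of \<beta> \<alpha>] by (fastforce simp: closed_points_def)
  qed
  then show "\<alpha> \<in> closed_points W" using \<alpha>(1) by (simp add: closed_points_def)
qed

section \<open>Generic enumerations\<close>

text \<open>Forcing conditions extending \<open>p\<close>. Prefixes of conditions are conditions, so
  \<open>p \<in> conds S p\<close> says that \<open>p\<close> is one itself.\<close>

definition conds :: "'a set \<Rightarrow> 'a list \<Rightarrow> 'a list set" where
  "conds S p = {r. distinct r \<and> set r \<subseteq> S \<and> prefix p r}"

lemma conds_refl: "r \<in> conds S p \<Longrightarrow> r \<in> conds S r"
  by (auto simp: conds_def)

lemma conds_trans: "q \<in> conds S p \<Longrightarrow> r \<in> conds S q \<Longrightarrow> r \<in> conds S p"
  using prefix_order.trans unfolding conds_def by blast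

text \<open>The sets in the family need not be dense: some initial segment of \<open>f\<close>
  either enters \<open>U\<close> or rules out entering it.\<close>

definition generic :: "'a set \<Rightarrow> 'a list set set \<Rightarrow> (nat \<Rightarrow> 'a) \<Rightarrow> bool" where
  "generic S \<U> f \<longleftrightarrow> (\<forall>U\<in>\<U>. \<exists>n. map f [0..<n] \<in> U \<or> conds S (map f [0..<n]) \<inter> U = {})"

lemma prefix_map_upt: "m \<le> n \<Longrightarrow> prefix (map f [0..<m]) (map f [0..<n])"
  by (metis le_add_diff_inverse map_append prefixI upt_add_eq_append zero_le)

lemma map_upt_conds:
  "bij_betw f UNIV S \<Longrightarrow> m \<le> n \<Longrightarrow> map f [0..<n] \<in> conds S (map f [0..<m])"
  unfolding conds_def bij_betw_def
  by (auto simp: distinct_map prefix_map_upt intro: inj_on_subset)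

text \<open>Density beyond stage \<open>m\<close> excludes the second alternative of genericity, as
  seen at the later of the two stages.\<close>

lemma generic_meets:
  assumes f: "generic S \<U> f" "bij_betw f UNIV S" "U \<in> \<U>"
    and dense: "\<And>q. q \<in> conds S (map f [0..<m]) \<Longrightarrow> conds S q \<inter> U \<noteq> {}"
  obtains n where "map f [0..<n] \<in> U"
proof -
  from f obtain n where n: "map f [0..<n] \<in> U \<or> conds S (map f [0..<n]) \<inter> U = {}"
    unfolding generic_def by blast
  have "conds S (map f [0..<max m n]) \<inter> U \<noteq> {}"
    using f(2) by (intro dense map_upt_conds) auto
  moreover have "map f [0..<max m n] \<in> conds S (map f [0..<n])"
    using f(2) by (intro map_upt_conds) auto
  ultimately have "conds S (map f [0..<n]) \<inter> U \<noteq> {}" using conds_trans by blast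
  with n that show thesis by blast
qed

lemma conds_extend:
  assumes "infinite S" "q \<in> conds S q"
  obtains r where "r \<in> conds S q" "length q < length r"
proof -
  obtain x where "x \<in> S" "x \<notin> set q"
    using assms(1) by (metis List.finite_set finite_subset subsetI)
  then have "q @ [x] \<in> conds S q" using assms(2) by (auto simp: conds_def)
  then show thesis using that by force
qed

text \<open>The Rasiowa-Sikorski construction: extend the condition step by step, deciding one set
  of the countable family at each step.\<close>

lemma generic_exists:
  assumes S: "countable S" "infinite S" and \<U>: "countable \<U>" and p: "p \<in> conds S p"
  obtains f where "bij_betw f UNIV S" "generic S \<U> f" "map f [0..<length p] = p"
proof -
  \<comment> \<open>The additional sets make the enumeration surjective.\<close>
  define \<V> where "\<V> = \<U> \<union> (\<lambda>x. {r. x \<in> set r}) ` S"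
  have "\<V> \<noteq> {}" "countable \<V>" using S \<U> by (auto simp: \<V>_def)
  then have en: "range (from_nat_into \<V>) = \<V>" by (rule range_from_nat_into)
  define good where "good i q r \<longleftrightarrow> r \<in> conds S q \<and> length q < length r \<and>
    (r \<in> from_nat_into \<V> i \<or> conds S r \<inter> from_nat_into \<V> i = {})" for i q r
  have step: "\<exists>r. good i q r" if q: "q \<in> conds S q" for i q
  proof -
    obtain r0 where r0: "r0 \<in> conds S q" "length q < length r0"
      using conds_extend[OF S(2) q] by blast
    show ?thesis
    proof (cases "conds S r0 \<inter> from_nat_into \<V> i = {}")
      case True
      then show ?thesis using r0 by (auto simp: good_def)
    next
      case False
      then obtain r where "r \<in> conds S r0" "r \<in> from_nat_into \<V> i" by blast
      moreover from this have "length r0 \<le> length r" by (auto simp: conds_def prefix_length_le)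
      ultimately show ?thesis using r0 conds_trans unfolding good_def by (metis order_less_le_trans)
    qed
  qed
  define Q where "Q = rec_nat p (\<lambda>i q. SOME r. good i q r)"
  have QS: "Q (Suc i) = (SOME r. good i (Q i) r)" for i by (simp add: Q_def)
  have Q0: "Q 0 = p" by (simp add: Q_def)
  have Qc: "Q i \<in> conds S (Q i)" for i
  proof (induction i)
    case (Suc i)
    then have "good i (Q i) (Q (Suc i))" unfolding QS using someI_ex[OF step] by simp
    then show ?case using conds_refl by (auto simp: good_def)
  qed (simp add: Q0 p)
  have Qg: "good i (Q i) (Q (Suc i))" for i unfolding QS using someI_ex[OF step[OF Qc]] by simp
  have Qlen: "i \<le> length (Q i)" for i
  proof (induction i)
    case (Suc i)
    then show ?case using Qg[of i] by (auto simp: good_def)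
  qed simp
  have Qpre: "prefix (Q i) (Q j)" if "i \<le> j" for i j
    using that
  proof (induction rule: dec_induct)
    case (step j)
    then show ?case using Qg[of j] prefix_order.trans by (auto simp: good_def conds_def)
  qed simp
  \<comment> \<open>\<open>Q (Suc n)\<close> has length at least \<open>Suc n\<close>, so the index
    \<open>n\<close> is in range.\<close>
  define f where "f n = Q (Suc n) ! n" for n
  have fQ: "f n = Q i ! n" if "n < length (Q i)" for n i
  proof -
    have "n < length (Q (Suc n))" using Qlen[of "Suc n"] by simp
    then show ?thesis using that Qpre[of i "Suc n"] Qpre[of "Suc n" i]
      unfolding f_def prefix_def by (metis nle_le nth_append)
  qed
  have map_f: "map f [0..<length (Q i)] = Q i" for i
    using fQ by (intro nth_equalityI) auto
  have "inj f"
  proof (rule injI)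
    fix m n assume mn: "f m = f n"
    let ?i = "Suc (max m n)"
    have l: "m < length (Q ?i)" "n < length (Q ?i)" using Qlen[of ?i] by auto
    have "distinct (Q ?i)" using Qc[of ?i] by (simp add: conds_def)
    then show "m = n" using mn l fQ[OF l(1)] fQ[OF l(2)] nth_eq_iff_index_eq by metis
  qed
  moreover have "range f \<subseteq> S"
  proof
    fix x assume "x \<in> range f"
    then obtain n where n: "x = f n" by blast
    have "n < length (Q (Suc n))" using Qlen[of "Suc n"] by simp
    then show "x \<in> S" using Qc[of "Suc n"] n unfolding f_def conds_def by auto
  qed
  moreover have gen: "\<exists>n. map f [0..<n] \<in> U \<or> conds S (map f [0..<n]) \<inter> U = {}" if "U \<in> \<V>" for U
  proof -
    have "U \<in> range (from_nat_into \<V>)" using en that by simp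
    then obtain i where "U = from_nat_into \<V> i" by (rule rangeE)
    then show ?thesis using Qg[of i] map_f[of "Suc i"] unfolding good_def by metis
  qed
  moreover have "S \<subseteq> range f"
  proof
    fix x assume x: "x \<in> S"
    then obtain n where n: "x \<in> set (map f [0..<n]) \<or>
        conds S (map f [0..<n]) \<inter> {r. x \<in> set r} = {}"
      using gen[of "{r. x \<in> set r}"] by (auto simp: \<V>_def)
    show "x \<in> range f"
    proof (rule ccontr)
      assume nx: "x \<notin> range f"
      have "map f [0..<n] @ [x] \<in> conds S (map f [0..<n])"
        using \<open>inj f\<close> \<open>range f \<subseteq> S\<close> x nx
        by (auto simp: conds_def distinct_map intro: inj_on_subset)
      then show False using n nx by auto
    qed
  qed
  ultimately have "bij_betw f UNIV S" "generic S \<U> f"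
    by (auto simp: bij_betw_def generic_def \<V>_def)
  moreover have "map f [0..<length p] = p" using map_f[of 0] by (simp add: Q0)
  ultimately show thesis by (rule that)
qed


section \<open>Forcing the rank of an element of the output\<close>

text \<open>The parameter \<open>P\<close> stands for an oracle procedure whose input is an enumeration of \<open>S\<close>:
  \<open>P q j k\<close> means that the finite part \<open>q\<close> of the enumeration already makes the procedure put
  \<open>j\<close> below \<open>k\<close>.\<close>

inductive forces_rank ::
  "nat set set \<Rightarrow> (nat set list \<Rightarrow> nat \<Rightarrow> nat \<Rightarrow> bool) \<Rightarrow> nat set list \<Rightarrow> nat \<Rightarrow> nat set \<Rightarrow> bool"
  for S P where
  "(\<And>q j. q \<in> conds S p \<Longrightarrow> P q j k \<Longrightarrow>
      \<exists>\<eta>. w1_less \<eta> \<xi> \<and> (\<exists>r\<in>conds S q. forces_rank S P r j \<eta>)) \<Longrightarrow>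
   (\<And>q \<eta>. q \<in> conds S p \<Longrightarrow> w1_less \<eta> \<xi> \<Longrightarrow>
      \<exists>j. \<exists>r\<in>conds S q. P r j k \<and> forces_rank S P r j \<eta>) \<Longrightarrow>
   forces_rank S P p k \<xi>"

definition below_set where
  "below_set S P \<xi> j = {r. \<exists>\<eta>. w1_less \<eta> \<xi> \<and> forces_rank S P r j \<eta>}"

definition above_set where
  "above_set S P \<eta> k = {r. \<exists>j. P r j k \<and> forces_rank S P r j \<eta>}"

definition rank_set where
  "rank_set S P \<xi> k = {r. forces_rank S P r k \<xi>}"

text \<open>The conditions at which one of the two clauses of \<open>forces_rank\<close> fails
  outright, so that every failure of forcing is witnessed by an extension.\<close>

definition not_rank_set where
  "not_rank_set S P \<xi> k = {q. (\<exists>j. P q j k \<and> conds S q \<inter> below_set S P \<xi> j = {}) \<or>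
     (\<exists>\<eta>. w1_less \<eta> \<xi> \<and> conds S q \<inter> above_set S P \<eta> k = {})}"

definition rank_family where
  "rank_family S P \<xi> = range (below_set S P \<xi>) \<union> range (above_set S P \<xi>) \<union>
     range (rank_set S P \<xi>) \<union> range (not_rank_set S P \<xi>)"

lemma rank_family_memI:
  "below_set S P \<xi> j \<in> rank_family S P \<xi>" "above_set S P \<xi> j \<in> rank_family S P \<xi>"
  "rank_set S P \<xi> j \<in> rank_family S P \<xi>" "not_rank_set S P \<xi> j \<in> rank_family S P \<xi>"
  by (auto simp: rank_family_def)

lemma countable_rank_family: "countable (rank_family S P \<xi>)"
  by (simp add: rank_family_def)

text \<open>Both clauses become density statements: densely, each predecessor of \<open>k\<close>
  gets a rank below \<xi>, and each rank below \<xi> is taken by a predecessor of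
  \<open>k\<close>.\<close>

lemma forces_rank_iff:
  "forces_rank S P p k \<xi> \<longleftrightarrow>
    (\<forall>q j. q \<in> conds S p \<longrightarrow> P q j k \<longrightarrow> conds S q \<inter> below_set S P \<xi> j \<noteq> {}) \<and>
    (\<forall>q \<eta>. q \<in> conds S p \<longrightarrow> w1_less \<eta> \<xi> \<longrightarrow> conds S q \<inter> above_set S P \<eta> k \<noteq> {})"
  by (subst forces_rank.simps) (fastforce simp: below_set_def above_set_def)

lemma forces_rank_below:
  "forces_rank S P p k \<xi> \<Longrightarrow> q \<in> conds S p \<Longrightarrow> P q j k \<Longrightarrow> conds S q \<inter> below_set S P \<xi> j \<noteq> {}"
  unfolding forces_rank_iff[of S P p k] by simp

lemma forces_rank_above:
  "forces_rank S P p k \<xi> \<Longrightarrow> q \<in> conds S p \<Longrightarrow> w1_less \<eta> \<xi> \<Longrightarrow> conds S q \<inter> above_set S P \<eta> k \<noteq> {}"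
  unfolding forces_rank_iff[of S P p k] by simp

lemma forces_rank_mono: "forces_rank S P p k \<xi> \<Longrightarrow> q \<in> conds S p \<Longrightarrow> forces_rank S P q k \<xi>"
  unfolding forces_rank_iff[of S P _ k] using conds_trans[of q S p] by meson

lemma not_forces_rank_iff:
  "\<not> forces_rank S P p k \<xi> \<longleftrightarrow> conds S p \<inter> not_rank_set S P \<xi> k \<noteq> {}"
  by (subst forces_rank_iff) (auto simp: not_rank_set_def)

text \<open>Abstracts from computability: forcing uses only that every output comparison which holds
  is settled by a finite part of the enumeration.\<close>

definition yields :: "(nat set list \<Rightarrow> nat \<Rightarrow> nat \<Rightarrow> bool) \<Rightarrow> nat set set \<Rightarrow> nat set \<Rightarrow> bool" where
  "yields P S \<alpha> \<longleftrightarrow> (\<forall>f. bij_betw f UNIV S \<longrightarrow>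
     (\<exists>g. bij_betw g UNIV (ord_dom \<alpha>) \<and>
        (\<forall>j k. w1_less (g j) (g k) \<longleftrightarrow> (\<exists>n. P (map f [0..<n]) j k))))"

definition extension_closed :: "('a list \<Rightarrow> nat \<Rightarrow> nat \<Rightarrow> bool) \<Rightarrow> bool" where
  "extension_closed P \<longleftrightarrow> (\<forall>q r j k. P q j k \<longrightarrow> prefix q r \<longrightarrow> P r j k)"

section \<open>Forcing and truth along a generic enumeration\<close>

locale generic_run =
  fixes S :: "nat set set" and P f g \<alpha> \<theta>
  assumes f: "bij_betw f UNIV S"
    and gen: "generic S (\<Union>\<xi>\<in>ord_dom \<theta>. rank_family S P \<xi>) f"
    and g: "bij_betw g UNIV (ord_dom \<alpha>)"
    and fg: "\<And>j k. w1_less (g j) (g k) \<longleftrightarrow> (\<exists>n. P (map f [0..<n]) j k)"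
    and P: "extension_closed P"
begin

lemma P_later: "P (map f [0..<m]) j k \<Longrightarrow> m \<le> n \<Longrightarrow> P (map f [0..<n]) j k"
  using P prefix_map_upt unfolding extension_closed_def by blast

lemma meets:
  assumes "U \<in> rank_family S P \<xi>" "w1_less \<xi> \<theta>"
    "\<And>q. q \<in> conds S (map f [0..<m]) \<Longrightarrow> conds S q \<inter> U \<noteq> {}"
  obtains n where "map f [0..<n] \<in> U"
proof -
  have "U \<in> (\<Union>\<xi>\<in>ord_dom \<theta>. rank_family S P \<xi>)"
    using assms(1,2) by (auto simp: ord_dom_def)
  then show thesis by (rule generic_meets[OF gen f]) (fact assms(3), fact that)
qed

lemma g_less: "w1_less (g j) \<alpha>"
  using g by (auto simp: bij_betw_def ord_dom_def)

lemma g_surj: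
  assumes "w1_less \<eta> \<alpha>"
  obtains j where "\<eta> = g j"
proof -
  have "\<eta> \<in> range g" using g assms by (simp add: bij_betw_def ord_dom_def)
  then show thesis by (rule rangeE) (rule that)
qed

text \<open>Forced ranks are true ranks. By induction, meeting \<open>below_set\<close> and
  \<open>above_set\<close> shows that \<open>g k\<close> and \<xi> have the same
  predecessors.\<close>

lemma forced_rank:
  "w1_less \<xi> \<theta> \<Longrightarrow> forces_rank S P (map f [0..<m]) k \<xi> \<Longrightarrow> g k = \<xi>"
proof (induction \<xi> arbitrary: m k rule: w1_less_induct)
  case (less \<xi>)
  have less_\<theta>: "w1_less \<eta> \<theta>" if "w1_less \<eta> \<xi>" for \<eta> using that less.prems(1) w1_less_trans by blast
  have "w1_less \<eta> \<xi>" if \<eta>: "w1_less \<eta> (g k)" for \<eta>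
  proof -
    have "w1_less \<eta> \<alpha>" using \<eta> g_less w1_less_trans by blast
    then obtain j where j: "\<eta> = g j" by (rule g_surj)
    then obtain n where n: "P (map f [0..<n]) j k" using fg \<eta> by blast
    \<comment> \<open>Beyond stage \<open>max m n\<close> the rank of \<open>k\<close> is still
      forced and \<open>j\<close> has been put below \<open>k\<close>.\<close>
    have "conds S q \<inter> below_set S P \<xi> j \<noteq> {}" if "q \<in> conds S (map f [0..<max m n])" for q
    proof -
      have "P q j k"
        using P_later[OF n, of "max m n"] P that unfolding extension_closed_def conds_def by auto
      moreover have "q \<in> conds S (map f [0..<m])"
        using that conds_trans map_upt_conds[OF f, of m "max m n"] by auto
      ultimately show ?thesis using forces_rank_below[OF less.prems(2)] by simp
    qed
    then obtain i where "map f [0..<i] \<in> below_set S P \<xi> j"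
      by (rule meets[OF rank_family_memI(1) less.prems(1)])
    then show ?thesis using less.IH less_\<theta> j unfolding below_set_def by blast
  qed
  moreover have "w1_less \<eta> (g k)" if \<eta>: "w1_less \<eta> \<xi>" for \<eta>
  proof -
    have "conds S q \<inter> above_set S P \<eta> k \<noteq> {}" if "q \<in> conds S (map f [0..<m])" for q
      using forces_rank_above[OF less.prems(2) that \<eta>] .
    then obtain i where "map f [0..<i] \<in> above_set S P \<eta> k"
      by (rule meets[OF rank_family_memI(2) less_\<theta>[OF \<eta>]])
    then show ?thesis using less.IH less_\<theta> \<eta> fg unfolding above_set_def by blast
  qed
  moreover have "g k \<in> Field omega1" "\<xi> \<in> Field omega1"
    using w1_less_Field[OF g_less] w1_less_Field[OF less.prems(1)] by auto
  ultimately show ?case by (intro w1_less_ext) auto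
qed

text \<open>If \<xi> were never forced, genericity would exclude it from some stage on, and
  \<open>f\<close> would meet \<open>not_rank_set\<close>. The forced ranks of the predecessors of
  \<open>k\<close>, given by induction, refute both ways of doing so.\<close>

lemma rank_is_forced:
  "w1_less \<xi> \<theta> \<Longrightarrow> g k = \<xi> \<Longrightarrow> \<exists>m. forces_rank S P (map f [0..<m]) k \<xi>"
proof (induction \<xi> arbitrary: k rule: w1_less_induct)
  case (less \<xi>)
  have less_\<theta>: "w1_less \<eta> \<theta>" if "w1_less \<eta> \<xi>" for \<eta> using that less.prems(1) w1_less_trans by blast
  show ?case
  proof (rule ccontr)
    assume not_forced: "\<not> ?case"
    have "rank_set S P \<xi> k \<in> (\<Union>\<xi>\<in>ord_dom \<theta>. rank_family S P \<xi>)"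
      using less.prems(1) rank_family_memI(3) by (auto simp: ord_dom_def)
    then obtain m where m: "conds S (map f [0..<m]) \<inter> rank_set S P \<xi> k = {}"
      using gen[unfolded generic_def, rule_format, of "rank_set S P \<xi> k"] not_forced
      by (auto simp: rank_set_def)
    have "conds S q \<inter> not_rank_set S P \<xi> k \<noteq> {}" if "q \<in> conds S (map f [0..<m])" for q
      using m that unfolding not_forces_rank_iff[symmetric] rank_set_def by blast
    then obtain n where "map f [0..<n] \<in> not_rank_set S P \<xi> k"
      by (rule meets[OF rank_family_memI(4) less.prems(1)])
    then consider j where "P (map f [0..<n]) j k" "conds S (map f [0..<n]) \<inter> below_set S P \<xi> j = {}"
      | \<eta> where "w1_less \<eta> \<xi>" "conds S (map f [0..<n]) \<inter> above_set S P \<eta> k = {}"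
      unfolding not_rank_set_def by blast
    then show False
    proof cases
      case 1
      \<comment> \<open>A later segment forces the true rank of \<open>j\<close>, which is below
        \<xi>, and so lies in the set claimed to be unreachable.\<close>
      then have lt: "w1_less (g j) \<xi>" using fg less.prems(2) by blast
      then obtain i where "forces_rank S P (map f [0..<i]) j (g j)"
        using less.IH less_\<theta> by blast
      then have "forces_rank S P (map f [0..<max n i]) j (g j)"
        using forces_rank_mono map_upt_conds[OF f] by (metis max.cobounded2)
      then show False using 1(2) lt map_upt_conds[OF f, of n "max n i"]
        unfolding below_set_def by auto
    next
      case 2
      then have "w1_less \<eta> \<alpha>" using less.prems(2) g_less w1_less_trans by blast
      \<comment> \<open>The rank \<eta> is realised by some \<open>j\<close> below \<open>k\<close>;
        a late enough segment both forces this rank and puts \<open>j\<close> below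
        \<open>k\<close>.\<close>
      then obtain j where j: "\<eta> = g j" by (rule g_surj)
      then obtain m where m: "P (map f [0..<m]) j k" using fg 2(1) less.prems(2) by blast
      obtain i where "forces_rank S P (map f [0..<i]) j \<eta>"
        using less.IH less_\<theta> 2(1) j by blast
      then have "forces_rank S P (map f [0..<max n (max m i)]) j \<eta>"
        using forces_rank_mono map_upt_conds[OF f, of i "max n (max m i)"] by auto
      moreover have "P (map f [0..<max n (max m i)]) j k" using P_later[OF m] by simp
      ultimately show False using 2(2) map_upt_conds[OF f, of n "max n (max m i)"]
        unfolding above_set_def by auto
    qed
  qed
qed

end

lemma generic_run_exists:
  assumes "countable S" "infinite S" "yields P S \<alpha>" "extension_closed P" "p \<in> conds S p"
  obtains f g where "generic_run S P f g \<alpha> \<theta>" "map f [0..<length p] = p"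
proof -
  have "countable (\<Union>\<xi>\<in>ord_dom \<theta>. rank_family S P \<xi>)"
    using countable_ord_dom countable_rank_family by blast
  then obtain f where f: "bij_betw f UNIV S" "generic S (\<Union>\<xi>\<in>ord_dom \<theta>. rank_family S P \<xi>) f"
    "map f [0..<length p] = p"
    using generic_exists assms(1,2,5) by metis
  then obtain g where "bij_betw g UNIV (ord_dom \<alpha>)"
    "\<forall>j k. w1_less (g j) (g k) \<longleftrightarrow> (\<exists>n. P (map f [0..<n]) j k)"
    using assms(3) unfolding yields_def by blast
  with f assms(4) have "generic_run S P f g \<alpha> \<theta>" by unfold_locales auto
  with f(3) that show thesis by blast
qed

section \<open>Reflecting the forcing relation of the whole of omega one\<close>

text \<open>A Loewenheim-Skolem condition: it makes the forcing relations over \<open>\<beta>\<close> and over \<open>omega1\<close>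
  agree on conditions and ranks below \<open>\<beta>\<close>.\<close>

definition reflects :: "(nat set list \<Rightarrow> nat \<Rightarrow> nat \<Rightarrow> bool) \<Rightarrow> nat set \<Rightarrow> bool" where
  "reflects P \<beta> \<longleftrightarrow> infinite (ord_dom \<beta>) \<and>
     (\<forall>\<xi>\<in>ord_dom \<beta>. \<forall>U\<in>rank_family (Field omega1) P \<xi>. \<forall>q\<in>lists (ord_dom \<beta>).
        conds (Field omega1) q \<inter> U \<noteq> {} \<longrightarrow> conds (ord_dom \<beta>) q \<inter> U \<noteq> {})"

lemma reflectsD:
  assumes "reflects P \<beta>" "w1_less \<xi> \<beta>" "U \<in> rank_family (Field omega1) P \<xi>" "set q \<subseteq> ord_dom \<beta>"
    "conds (Field omega1) q \<inter> U \<noteq> {}"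
  shows "conds (ord_dom \<beta>) q \<inter> U \<noteq> {}"
proof -
  have "\<xi> \<in> ord_dom \<beta>" "q \<in> lists (ord_dom \<beta>)" using assms(2,4) by (auto simp: ord_dom_def)
  with assms(1,3,5) show ?thesis unfolding reflects_def by blast
qed

lemma conds_ord_dom: "r \<in> conds (ord_dom \<beta>) q \<Longrightarrow> r \<in> conds (Field omega1) q"
  using ord_dom_Field by (auto simp: conds_def)

lemma conds_set: "r \<in> conds S q \<Longrightarrow> set r \<subseteq> S"
  by (simp add: conds_def)

text \<open>By induction the target sets over \<beta> and over \<open>omega1\<close> agree on
  conditions below \<beta>; reflection then makes their reachability agree.\<close>

lemma forces_rank_reflects:
  assumes "reflects P \<beta>"
  shows "w1_less \<xi> \<beta> \<Longrightarrow> set p \<subseteq> ord_dom \<beta> \<Longrightarrow>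
    forces_rank (ord_dom \<beta>) P p k \<xi> \<longleftrightarrow> forces_rank (Field omega1) P p k \<xi>"
proof (induction \<xi> arbitrary: p k rule: w1_less_induct)
  case (less \<xi>)
  let ?S = "ord_dom \<beta>" and ?F = "Field omega1"
  have less_\<beta>: "w1_less \<eta> \<beta>" if "w1_less \<eta> \<xi>" for \<eta> using that less.prems(1) w1_less_trans by blast
  have below: "conds ?S q \<inter> below_set ?S P \<xi> j \<noteq> {} \<longleftrightarrow> conds ?F q \<inter> below_set ?F P \<xi> j \<noteq> {}"
    if "set q \<subseteq> ?S" for q j
  proof -
    have "conds ?S q \<inter> below_set ?S P \<xi> j = conds ?S q \<inter> below_set ?F P \<xi> j"
      unfolding below_set_def using less.IH less_\<beta> conds_set by blast
    then show ?thesis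
      using reflectsD[OF assms less.prems(1) rank_family_memI(1) that] conds_ord_dom by blast
  qed
  have above: "conds ?S q \<inter> above_set ?S P \<eta> k \<noteq> {} \<longleftrightarrow> conds ?F q \<inter> above_set ?F P \<eta> k \<noteq> {}"
    if "set q \<subseteq> ?S" "w1_less \<eta> \<xi>" for q \<eta>
  proof -
    have "conds ?S q \<inter> above_set ?S P \<eta> k = conds ?S q \<inter> above_set ?F P \<eta> k"
      unfolding above_set_def using less.IH less_\<beta> conds_set that(2) by blast
    then show ?thesis
      using reflectsD[OF assms less_\<beta>[OF that(2)] rank_family_memI(2) that(1)] conds_ord_dom by blast
  qed
  show ?case
  proof
    assume "forces_rank ?F P p k \<xi>"
    then show "forces_rank ?S P p k \<xi>"
      unfolding forces_rank_iff[of _ P p k \<xi>] using below above conds_ord_dom conds_set by metis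
  next
    assume S: "forces_rank ?S P p k \<xi>"
    show "forces_rank ?F P p k \<xi>"
    proof (rule ccontr)
      assume "\<not> ?thesis"
      \<comment> \<open>Conditions over \<open>omega1\<close> may leave \<beta>, but reflection of
        \<open>not_rank_set\<close> yields a refuting condition with entries below \<beta>.\<close>
      then obtain q where q: "q \<in> conds ?S p" "q \<in> not_rank_set ?F P \<xi> k"
        using reflectsD[OF assms less.prems(1) rank_family_memI(4) less.prems(2)]
        unfolding not_forces_rank_iff by blast
      then have "set q \<subseteq> ?S" using conds_set by blast
      then show False using q S below above
        unfolding forces_rank_iff[of _ P p k \<xi>] not_rank_set_def by blast
    qed
  qed
qed

text \<open>If \<alpha> were smaller, the output \<alpha>' would contain a number of rank \<alpha>.
  Forcing this fact transfers from \<beta>' to \<open>omega1\<close> and down to \<beta>, where the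
  output \<alpha> has no element of rank \<alpha>.\<close>

lemma reflects_yields_not_less:
  assumes P: "extension_closed P"
    and \<beta>: "reflects P \<beta>" "w1_less \<alpha> \<beta>" "yields P (ord_dom \<beta>) \<alpha>"
    and \<beta>': "reflects P \<beta>'" "w1_less \<alpha>' \<beta>'" "yields P (ord_dom \<beta>') \<alpha>'"
  shows "\<not> w1_less \<alpha> \<alpha>'"
proof
  assume \<alpha>: "w1_less \<alpha> \<alpha>'"
  have inf: "infinite (ord_dom \<beta>)" "infinite (ord_dom \<beta>')"
    using \<beta>(1) \<beta>'(1) by (auto simp: reflects_def)
  obtain f' g' where "generic_run (ord_dom \<beta>') P f' g' \<alpha>' \<beta>'"
    using generic_run_exists[OF countable_ord_dom inf(2) \<beta>'(3) P, of "[]"]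
    by (auto simp: conds_def)
  then interpret r': generic_run "ord_dom \<beta>'" P f' g' \<alpha>' \<beta>' .
  have \<alpha>\<beta>': "w1_less \<alpha> \<beta>'" using \<alpha> \<beta>'(2) w1_less_trans by blast
  have "\<alpha> \<in> range g'" using \<alpha> r'.g by (simp add: bij_betw_def ord_dom_def)
  then obtain k where "g' k = \<alpha>" by blast
  then obtain m where m: "forces_rank (ord_dom \<beta>') P (map f' [0..<m]) k \<alpha>"
    using r'.rank_is_forced \<alpha>\<beta>' by blast
  have "map f' [0..<m] \<in> conds (ord_dom \<beta>') (map f' [0..<0])"
    using map_upt_conds[OF r'.f] by blast
  moreover from this have "forces_rank (Field omega1) P (map f' [0..<m]) k \<alpha>"
    using m forces_rank_reflects[OF \<beta>'(1) \<alpha>\<beta>'] conds_set by blast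
  ultimately have "conds (Field omega1) [] \<inter> rank_set (Field omega1) P \<alpha> k \<noteq> {}"
    using conds_ord_dom by (auto simp: rank_set_def)
  then obtain p where p: "p \<in> conds (ord_dom \<beta>) []" "forces_rank (Field omega1) P p k \<alpha>"
    using reflectsD[OF \<beta>(1,2) rank_family_memI(3), of "[]" k] by (auto simp: rank_set_def)
  then have "forces_rank (ord_dom \<beta>) P p k \<alpha>"
    using forces_rank_reflects[OF \<beta>(1,2)] conds_set by blast
  \<comment> \<open>The generic enumeration starts with \<open>p\<close>, so what \<open>p\<close>
    forces comes true.\<close>
  moreover obtain f g where "generic_run (ord_dom \<beta>) P f g \<alpha> \<beta>" "map f [0..<length p] = p"
    using generic_run_exists[OF countable_ord_dom inf(1) \<beta>(3) P conds_refl[OF p(1)]] by blast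
  ultimately have "g k = \<alpha>" using generic_run.forced_rank[OF _ \<beta>(2)] by metis
  then show False
    using generic_run.g_less[OF \<open>generic_run (ord_dom \<beta>) P f g \<alpha> \<beta>\<close>, of k] by simp
qed

lemma reflects_yields_unique:
  assumes "extension_closed P"
    and "reflects P \<beta>" "w1_less \<alpha> \<beta>" "yields P (ord_dom \<beta>) \<alpha>"
    and "reflects P \<beta>'" "w1_less \<alpha>' \<beta>'" "yields P (ord_dom \<beta>') \<alpha>'"
  shows "\<alpha> = \<alpha>'"
  using reflects_yields_not_less[OF assms] reflects_yields_not_less[OF assms(1,5,6,7,2,3,4)]
    w1_less_linear w1_less_Field assms(3,6) by blast

section \<open>Oracle procedures on copies of ordinals\<close>

definition compat :: "nat set list \<Rightarrow> nat set \<Rightarrow> bool" where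
  "compat q X \<longleftrightarrow> (\<forall>i<length q. \<forall>j<length q.
     (2 * prod_encode (i, j) \<in> X \<longleftrightarrow> i = j) \<and>
     (2 * prod_encode (i, j) + 1 \<in> X \<longleftrightarrow> w1_less (q ! i) (q ! j)))"

text \<open>Quantifying over all compatible total oracles replaces computation from a partial oracle
  and makes the relation stable under extension.\<close>

definition decides_less :: "rf \<Rightarrow> nat set list \<Rightarrow> nat \<Rightarrow> nat \<Rightarrow> bool" where
  "decides_less e q j k \<longleftrightarrow>
     (\<forall>X. compat q X \<longrightarrow> ev (\<lambda>x. x \<in> X) e [2 * prod_encode (j, k) + 1] 1)"

lemma compat_prefix: "compat r X \<Longrightarrow> prefix q r \<Longrightarrow> compat q X"
  unfolding compat_def prefix_def by (auto simp: nth_append)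

lemma extension_closed_decides_less: "extension_closed (decides_less e)"
  using compat_prefix unfolding extension_closed_def decides_less_def by blast

lemma compat_diag: "compat (map f [0..<n]) (diag (\<lambda>i j. w1_less (f i) (f j)))"
  by (simp add: compat_def even_mem_diag odd_mem_diag del: One_nat_def)

text \<open>The pairing function dominates its arguments, so a code below \<open>n\<close> mentions
  only indices below \<open>n\<close>.\<close>

lemma compat_agree:
  assumes "compat (map f [0..<n]) X" "x < n"
  shows "x \<in> X \<longleftrightarrow> x \<in> diag (\<lambda>i j. w1_less (f i) (f j))"
proof -
  obtain i j where ij: "x div 2 = prod_encode (i, j)" by (metis prod_decode_inverse surj_pair)
  have "i < n" "j < n"
    using le_prod_encode_1[of i j] le_prod_encode_2[of j i] ij assms(2) by linarith+
  moreover have "x = 2 * prod_encode (i, j) \<or> x = 2 * prod_encode (i, j) + 1"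
    using ij by linarith
  ultimately show ?thesis
    using assms(1) even_mem_diag odd_mem_diag unfolding compat_def by auto
qed

text \<open>Forwards this is the use principle; backwards the diagram is itself a compatible oracle,
  and evaluation is single-valued.\<close>

lemma computes_diag_iff:
  assumes "computes e (diag (\<lambda>i j. w1_less (f i) (f j))) (diag R)"
  shows "R j k \<longleftrightarrow> (\<exists>n. decides_less e (map f [0..<n]) j k)"
proof
  let ?B = "diag (\<lambda>i j. w1_less (f i) (f j))" and ?x = "2 * prod_encode (j, k) + 1"
  have out: "ev (\<lambda>x. x \<in> ?B) e [?x] (if R j k then 1 else 0)"
    using assms[unfolded computes_def, rule_format, of ?x] by (simp only: odd_mem_diag)
  {
    assume "R j k"
    with out have "ev (\<lambda>x. x \<in> ?B) e [?x] 1" by simp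
    from ev_use[OF this]
    obtain N where N: "\<And>Y. \<forall>i<N. (i \<in> ?B) = Y i \<Longrightarrow> ev Y e [?x] 1" by blast
    have "decides_less e (map f [0..<N]) j k"
      unfolding decides_less_def
    proof (intro allI impI N)
      fix X i assume "compat (map f [0..<N]) X" "i < N"
      then show "(i \<in> ?B) = (i \<in> X)" using compat_agree by blast
    qed
    then show "\<exists>n. decides_less e (map f [0..<n]) j k" ..
  next
    assume "\<exists>n. decides_less e (map f [0..<n]) j k"
    then have "ev (\<lambda>x. x \<in> ?B) e [?x] 1"
      using compat_diag unfolding decides_less_def by blast
    then show "R j k" using ev_functional[OF out, of 1] by (simp split: if_splits)
  }
qed

definition reduces_via :: "rf \<Rightarrow> nat set \<Rightarrow> nat set \<Rightarrow> bool" where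
  "reduces_via e \<alpha> \<beta> \<longleftrightarrow> (\<forall>B. is_copy (ord_dom \<beta>) w1_less B \<longrightarrow>
     (\<exists>D. is_copy (ord_dom \<alpha>) w1_less D \<and> computes e B D))"

lemma ord_medv_le_iff: "ord_medv_le \<alpha> \<beta> \<longleftrightarrow> (\<exists>e. reduces_via e \<alpha> \<beta>)"
  by (simp add: ord_medv_le_def medv_le_def reduces_via_def)

lemma reduces_via_yields:
  assumes "reduces_via e \<alpha> \<beta>"
  shows "yields (decides_less e) (ord_dom \<beta>) \<alpha>"
  unfolding yields_def
proof (intro allI impI)
  fix f :: "nat \<Rightarrow> nat set" assume "bij_betw f UNIV (ord_dom \<beta>)"
  then have "is_copy (ord_dom \<beta>) w1_less (diag (\<lambda>i j. w1_less (f i) (f j)))"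
    by (auto simp: is_copy_def)
  then obtain g where "bij_betw g UNIV (ord_dom \<alpha>)"
    "computes e (diag (\<lambda>i j. w1_less (f i) (f j))) (diag (\<lambda>i j. w1_less (g i) (g j)))"
    using assms unfolding reduces_via_def is_copy_def by blast
  then show "\<exists>g. bij_betw g UNIV (ord_dom \<alpha>) \<and>
      (\<forall>j k. w1_less (g j) (g k) \<longleftrightarrow> (\<exists>n. decides_less e (map f [0..<n]) j k))"
    using computes_diag_iff by blast
qed

section \<open>Uniqueness of the output ordinal\<close>

lemma ord_iso_unique:
  assumes g: "bij_betw g UNIV (ord_dom \<alpha>)" and h: "bij_betw h UNIV (ord_dom \<beta>)"
    and iso: "\<And>j k. w1_less (g j) (g k) \<longleftrightarrow> w1_less (h j) (h k)"
  shows "g k = h k"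
proof -
  have "\<forall>k. g k = \<xi> \<longrightarrow> h k = \<xi>" for \<xi>
  proof (induction \<xi> rule: w1_less_induct)
    case (less \<xi>)
    show ?case
    proof (intro allI impI)
      fix k assume k: "g k = \<xi>"
      have gd: "w1_less (g k) \<alpha>" and hd: "w1_less (h k) \<beta>"
        using g h by (auto simp: bij_betw_def ord_dom_def)
      have "w1_less \<eta> (h k)" if "w1_less \<eta> \<xi>" for \<eta>
      proof -
        have "\<eta> \<in> ord_dom \<alpha>" using that k gd w1_less_trans by (auto simp: ord_dom_def)
        then obtain j where "\<eta> = g j" using g by (auto simp: bij_betw_def)
        then show ?thesis using that iso k less by metis
      qed
      moreover have "w1_less \<eta> \<xi>" if "w1_less \<eta> (h k)" for \<eta>
      proof -
        have "\<eta> \<in> ord_dom \<beta>" using that hd w1_less_trans by (auto simp: ord_dom_def)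
        then obtain j where "\<eta> = h j" using h by (auto simp: bij_betw_def)
        then show ?thesis using that iso k less by metis
      qed
      moreover have "h k \<in> Field omega1" "\<xi> \<in> Field omega1"
        using w1_less_Field[OF gd] w1_less_Field[OF hd] k by auto
      ultimately show "h k = \<xi>" by (intro w1_less_ext) auto
    qed
  qed
  then show ?thesis by blast
qed

text \<open>On one fixed enumeration both outputs are the same order on the natural numbers, and
  ordinals are rigid.\<close>

lemma yields_unique:
  assumes "countable S" "infinite S" "yields P S \<alpha>" "yields P S \<beta>"
    "\<alpha> \<in> Field omega1" "\<beta> \<in> Field omega1"
  shows "\<alpha> = \<beta>"
proof -
  obtain f :: "nat \<Rightarrow> nat set" where f: "bij_betw f UNIV S"
    using bij_betw_from_nat_into[OF assms(1,2)] by blast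
  obtain g where g: "bij_betw g UNIV (ord_dom \<alpha>)"
    and g_less: "\<forall>j k. w1_less (g j) (g k) \<longleftrightarrow> (\<exists>n. P (map f [0..<n]) j k)"
    using assms(3) f unfolding yields_def by blast
  obtain h where h: "bij_betw h UNIV (ord_dom \<beta>)"
    and h_less: "\<forall>j k. w1_less (h j) (h k) \<longleftrightarrow> (\<exists>n. P (map f [0..<n]) j k)"
    using assms(4) f unfolding yields_def by blast
  have "g k = h k" for k using ord_iso_unique[OF g h] g_less h_less by simp
  then have "ord_dom \<alpha> = ord_dom \<beta>"
    using g h by (simp add: bij_betw_def image_def)
  then show ?thesis
    by (intro w1_less_ext assms(5,6)) (auto simp: ord_dom_def set_eq_iff)
qed

lemma countable_if_unique_index:
  fixes R :: "'i::countable \<Rightarrow> 'a \<Rightarrow> bool"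
  assumes "\<And>e x y. R e x \<Longrightarrow> R e y \<Longrightarrow> x = y"
  shows "countable {x. \<exists>e. R e x}"
proof -
  have "{x. \<exists>e. R e x} \<subseteq> (\<lambda>e. THE x. R e x) ` UNIV"
  proof
    fix x assume "x \<in> {x. \<exists>e. R e x}"
    then obtain e where e: "R e x" by blast
    then have "(THE x. R e x) = x" using assms by blast
    then show "x \<in> (\<lambda>e. THE x. R e x) ` UNIV" by blast
  qed
  then show ?thesis by (rule countable_subset) simp
qed

section \<open>The club\<close>

text \<open>A Skolem function: the entries of a chosen extension of \<open>q\<close> in
  \<open>U\<close>, or the empty set if there is none.\<close>

definition witness :: "nat set list \<Rightarrow> nat set list set \<Rightarrow> nat set set" where
  "witness q U = (if conds (Field omega1) q \<inter> U = {} then {}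
     else set (SOME r. r \<in> conds (Field omega1) q \<inter> U))"

lemma witness_SOME:
  "conds (Field omega1) q \<inter> U \<noteq> {} \<Longrightarrow>
    \<exists>r. r \<in> conds (Field omega1) q \<inter> U \<and> witness q U = set r"
  unfolding witness_def using some_in_eq[of "conds (Field omega1) q \<inter> U"] by auto

lemma countable_witness: "countable (witness q U)"
  by (simp add: witness_def countable_finite)

lemma witness_Field: "witness q U \<subseteq> Field omega1"
proof (cases "conds (Field omega1) q \<inter> U = {}")
  case False
  then show ?thesis using witness_SOME[OF False] conds_set by fastforce
qed (simp add: witness_def)

text \<open>A rank \<open>\<xi>\<close> and a condition \<open>q\<close> are passed as the single list \<open>\<xi> # q\<close>; for the empty list
  the value of \<open>hd\<close> is arbitrary, which is harmless.\<close>

definition reflecting_closure :: "nat set set \<Rightarrow> nat set list \<Rightarrow> nat set set" where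
  "reflecting_closure I l = I \<union>
     (\<Union>e. \<Union>U\<in>rank_family (Field omega1) (decides_less e) (hd l). witness (tl l) U)"

lemma reflecting_closure_reflects:
  assumes \<beta>: "\<beta> \<in> closed_points W" and W: "\<And>l. reflecting_closure I l \<subseteq> W l" and I: "infinite I"
  shows "reflects (decides_less e) \<beta>"
  unfolding reflects_def
proof (intro conjI ballI impI)
  have closed: "reflecting_closure I l \<subseteq> ord_dom \<beta>" if "l \<in> lists (ord_dom \<beta>)" for l
    using \<beta> W that unfolding closed_points_def by blast
  \<comment> \<open>The value at the empty list already contains \<open>I\<close>.\<close>
  show "infinite (ord_dom \<beta>)"
    using closed[of "[]"] I finite_subset unfolding reflecting_closure_def by auto
  fix \<xi> U q
  assume *: "\<xi> \<in> ord_dom \<beta>" "U \<in> rank_family (Field omega1) (decides_less e) \<xi>"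
    "q \<in> lists (ord_dom \<beta>)" "conds (Field omega1) q \<inter> U \<noteq> {}"
  obtain r where r: "r \<in> conds (Field omega1) q \<inter> U" "witness q U = set r"
    using witness_SOME[OF *(4)] by blast
  have "witness q U \<subseteq> reflecting_closure I (\<xi> # q)"
    using *(2) unfolding reflecting_closure_def by auto
  also have "\<dots> \<subseteq> ord_dom \<beta>" using *(1,3) by (intro closed) auto
  finally have "r \<in> conds (ord_dom \<beta>) q" using r by (simp add: conds_def)
  then show "conds (ord_dom \<beta>) q \<inter> U \<noteq> {}" using r(1) by blast
qed

lemma countable_reflecting_closure: "countable I \<Longrightarrow> countable (reflecting_closure I l)"
  unfolding reflecting_closure_def
  by (intro countable_Un countable_UN countable_rank_family countable_witness) auto

theorem theorem2:
  shows "\<exists>A. club_w1 A \<and>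
           (\<forall>\<alpha>\<in>A. \<forall>\<beta>\<in>A. \<alpha> \<noteq> \<beta> \<longrightarrow> \<not> ord_medv_le \<alpha> \<beta> \<and> \<not> ord_medv_le \<beta> \<alpha>)"
proof -
  obtain I where I: "I \<subseteq> Field omega1" "countable I" "infinite I"
    using infinite_countable_subset'[of "Field omega1"] uncountable_infinite[OF uncountable_Field_omega1]
    by auto
  define bad where "bad = {\<alpha>. \<exists>e. \<exists>\<beta>. reflects (decides_less e) \<beta> \<and> w1_less \<alpha> \<beta> \<and> reduces_via e \<alpha> \<beta>}"
  \<comment> \<open>A finite \<alpha> has no copy with domain omega, so every ordinal reduces to it
    vacuously; infinity of \<alpha> keeps the set countable.\<close>
  define above where "above \<alpha> = {\<beta>. \<exists>e. infinite (ord_dom \<alpha>) \<and> \<beta> \<in> Field omega1 \<and> reduces_via e \<beta> \<alpha>}" for \<alpha>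
  \<comment> \<open>\<open>bad\<close> belongs to every value, including that at the empty list, so
    it lies below every closed point; \<open>[\<alpha>]\<close> brings in
    \<open>above \<alpha>\<close>.\<close>
  define W where "W l = reflecting_closure I l \<union> bad \<union> above (hd l)" for l
  have "countable bad"
    \<comment> \<open>Each procedure accounts for at most one bad ordinal, whatever the larger
      ordinal \<beta> is.\<close>
    unfolding bad_def using reflects_yields_unique[OF extension_closed_decides_less] reduces_via_yields
    by (intro countable_if_unique_index) blast
  moreover have "countable (above \<alpha>)" for \<alpha>
    unfolding above_def using yields_unique[OF countable_ord_dom] reduces_via_yields
    by (intro countable_if_unique_index) blast
  ultimately have "countable (W l)" for l
    using countable_reflecting_closure[OF I(2)] by (simp add: W_def)
  moreover have "W l \<subseteq> Field omega1" for l
    using I(1) witness_Field w1_less_Field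
    unfolding W_def reflecting_closure_def bad_def above_def by blast
  ultimately have "club_w1 (closed_points W)" by (rule club_closed_points)
  moreover have "\<not> ord_medv_le \<alpha> \<beta> \<and> \<not> ord_medv_le \<beta> \<alpha>"
    if \<alpha>: "\<alpha> \<in> closed_points W" and \<beta>: "\<beta> \<in> closed_points W" and less: "w1_less \<alpha> \<beta>" for \<alpha> \<beta>
  proof -
    have refl: "reflects (decides_less e) \<gamma>" if "\<gamma> \<in> closed_points W" for e \<gamma>
      using that I(3) by (intro reflecting_closure_reflects) (auto simp: W_def)
    have "bad \<subseteq> ord_dom \<alpha>" 
      using \<alpha> unfolding closed_points_def W_def by blast
    then have "\<alpha> \<notin> bad" by (auto simp: ord_dom_def)
    then have "\<not> ord_medv_le \<alpha> \<beta>"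
      using refl[OF \<beta>] less unfolding bad_def ord_medv_le_iff by blast
    moreover have "above \<alpha> \<subseteq> ord_dom \<beta>"
    proof -
      have "W [\<alpha>] \<subseteq> ord_dom \<beta>" using \<beta> less by (auto simp: closed_points_def ord_dom_def)
      then show ?thesis by (auto simp: W_def)
    qed
    then have "\<beta> \<notin> above \<alpha>" by (auto simp: ord_dom_def)
    then have "\<not> ord_medv_le \<beta> \<alpha>"
      using refl[OF \<alpha>] w1_less_Field[OF less] unfolding above_def ord_medv_le_iff reflects_def by blast
    ultimately show ?thesis by blast
  qed
  moreover have "w1_less \<alpha> \<beta> \<or> w1_less \<beta> \<alpha>"
    if "\<alpha> \<in> closed_points W" "\<beta> \<in> closed_points W" "\<alpha> \<noteq> \<beta>" for \<alpha> \<beta>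
    using that w1_less_linear by (auto simp: closed_points_def)
  ultimately show ?thesis by blast
qed

end
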